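(* Assume that $f'$ exists and is continuous in a neighborhood of $-\theta$, and that $h_n=cn^{-d}$ with $c>0$ and $\frac14<d<\frac12$. If the kernel $k$ is symmetric around the origin and $$0<\lim_{n\to\infty}V_\theta\Bigl[1-K\Bigl(-\frac{X_i}{h_n}\Bigr)\Bigr]<\infty,$$ then the standardized sign and smoothed sign statistics are equivalent, that is, $$\lim_{n\to\infty}E_\theta\left\{\frac{S-E_\theta(S)}{\sqrt{V_\theta(S)}}-\frac{\widetilde S-E_\theta(\widetilde S)}{\sqrt{V_\theta(\widetilde S)}}\right\}^2=0.$$
   Context: $X_1,X_2,\dots,X_n$ are i.i.d. real random variables with distribution function $F(x-\theta)$, where $\theta\in\mathbb R$ is a fixed location parameter and $F$ has a density $f$ satisfying $f(-x)=f(x)$ for all $x$. $E_\theta$ and $V_\theta$ denote expectation and variance under this model. The kernel $k:\mathbb R\to\mathbb R$ satisfies $\int_{-\infty}^{\infty}k(u)\,du=1$ (it may take negative values), and is called symmetric (around the origin) if $k(-u)=k(u)$. Put $K(t)=\int_{-\infty}^t k(u)\,du$. The bandwidth $h_n>0$ satisfies $h_n\to0$ as $n\to\infty$. Let $\psi(x)=1$ for $x\ge0$ and $\psi(x)=0$ for $x<0$. The sign statistic and the smoothed sign statistic are $$S=\sum_{i=1}^n\psi(X_i),\qquad \widetilde S=n-\sum_{i=1}^nK\Bigl(-\frac{X_i}{h_n}\Bigr).$$ *)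

theory Defs
  imports "HOL-Probability.Probability"
begin

definition has_density :: "(real \<Rightarrow> real) \<Rightarrow> (real \<Rightarrow> real) \<Rightarrow> bool" where
  "has_density F f \<longleftrightarrow>
     (\<forall>x. 0 \<le> f x) \<and> has_bochner_integral lborel f 1 \<and> (\<forall>x. F x = (LBINT t:{..x}. f t))"

definition is_kernel :: "(real \<Rightarrow> real) \<Rightarrow> bool" where
  "is_kernel k \<longleftrightarrow> has_bochner_integral lborel k 1"

definition kernel_cdf :: "(real \<Rightarrow> real) \<Rightarrow> real \<Rightarrow> real" where
  "kernel_cdf k t = (LBINT u:{..t}. k u)"

definition psi :: "real \<Rightarrow> real" where
  "psi x = (if x \<ge> 0 then 1 else 0)"

text \<open>The sample of size \<open>n\<close> consists of \<open>X 1, \<dots>, X n\<close>; \<open>X 0\<close> is never used.\<close>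

definition sign_stat :: "(nat \<Rightarrow> 'a \<Rightarrow> real) \<Rightarrow> nat \<Rightarrow> 'a \<Rightarrow> real" where
  "sign_stat X n \<omega> = (\<Sum>i=1..n. psi (X i \<omega>))"

definition smoothed_sign_stat ::
  "(real \<Rightarrow> real) \<Rightarrow> (nat \<Rightarrow> real) \<Rightarrow> (nat \<Rightarrow> 'a \<Rightarrow> real) \<Rightarrow> nat \<Rightarrow> 'a \<Rightarrow> real" where
  "smoothed_sign_stat k h X n \<omega> = real n - (\<Sum>i=1..n. kernel_cdf k (- (X i \<omega>) / h n))"

definition standardized :: "'a measure \<Rightarrow> ('a \<Rightarrow> real) \<Rightarrow> 'a \<Rightarrow> real" where
  "standardized M Z \<omega> =
     (Z \<omega> - prob_space.expectation M Z) / sqrt (prob_space.variance M Z)"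

end

theory Submission
  imports Defs
begin

text \<open>
  Both statistics are sums of one function over the sample: \<open>S\<close> sums \<open>\<psi> (X\<^sub>i)\<close>, and
  \<open>S~\<close> sums \<open>g\<^sub>n (X\<^sub>i)\<close> with \<open>g\<^sub>n x = 1 - K (- x / h\<^sub>n)\<close>. For an i.i.d. sample
  the standardized sum is the sum of the standardized summands divided by \<open>\<surd>n\<close>, and centred
  independent summands are orthogonal. Hence the factor \<open>n\<close> cancels, and the mean squared
  difference of the two standardized statistics is exactly the mean squared difference of the
  standardizations of \<open>\<psi>\<close> and \<open>g\<^sub>n\<close> under the law \<open>D\<close> of a single observation
  (\<open>expectation_square_standardized_diff\<close>).

  It remains to let \<open>n\<close> grow in this one-observation quantity. Since \<open>K\<close> tends to 0 and to 1
  at the two ends of the line and \<open>h\<^sub>n\<close> tends to 0 from above, \<open>g\<^sub>n x\<close> tends to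
  \<open>\<psi> x\<close> for every \<open>x \<noteq> 0\<close>; the origin does not matter, because a distribution
  function with a density is continuous and so \<open>D\<close> has no atom. The functions \<open>g\<^sub>n\<close> are
  uniformly bounded, as \<open>\<bar>K\<bar>\<close> is at most the integral of \<open>\<bar>k\<bar>\<close>. Bounded convergence
  gives convergence of means and variances. In particular the limiting variance \<open>L\<close> is the
  variance of \<open>\<psi>\<close>, which is therefore positive, so that the standardizing factors converge
  too, and a second use of bounded convergence (\<open>standardized_tendsto_bounded\<close>) finishes the
  proof.
\<close>

section \<open>Integrals over half-lines and the smoothed step\<close>

text \<open>
  Continuity of a distribution function with a density and the two limits of \<open>K\<close> at infinity
  are the same dominated convergence argument, with \<open>\<bar>g\<bar>\<close> as dominating function; only the
  pointwise limit \<open>\<phi>\<close> of the indicators of the half-lines differs.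
\<close>

lemma half_line_integral_tendsto:
  fixes g \<phi> s :: "_ \<Rightarrow> real"
  assumes g: "integrable lborel g" and \<phi>: "\<phi> \<in> borel_measurable borel"
    and lim: "AE u in lborel. (\<lambda>n. indicat_real {..s n} u) \<longlonglongrightarrow> \<phi> u"
  shows "(\<lambda>n. LBINT u:{..s n}. g u) \<longlonglongrightarrow> (LBINT u. \<phi> u * g u)"
  unfolding set_lebesgue_integral_def real_scaleR_def
proof (rule integral_dominated_convergence[where w = "\<lambda>u. \<bar>g u\<bar>"])
  show "(\<lambda>u. \<phi> u * g u) \<in> borel_measurable lborel"
    using g \<phi> by (auto dest: borel_measurable_integrable)
  show "integrable lborel (\<lambda>u. \<bar>g u\<bar>)" using g by simp
  show "AE u in lborel. (\<lambda>n. indicat_real {..s n} u * g u) \<longlonglongrightarrow> \<phi> u * g u"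
    using lim by eventually_elim (intro tendsto_intros)
  show "(\<lambda>u. indicat_real {..s n} u * g u) \<in> borel_measurable lborel" for n
    using g by (auto dest: borel_measurable_integrable)
  show "AE u in lborel. norm (indicat_real {..s n} u * g u) \<le> \<bar>g u\<bar>" for n
    by (auto simp: indicator_def)
qed

text \<open>
  If \<open>s n\<close> tends to \<open>x\<close>, the indicators of \<open>{..s n}\<close> converge to that of
  \<open>{..x}\<close> off \<open>x\<close>, hence almost everywhere.
\<close>

lemma isCont_half_line_integral:
  fixes g :: "real \<Rightarrow> real"
  assumes g: "integrable lborel g"
  shows "isCont (\<lambda>t. LBINT u:{..t}. g u) x"
  unfolding continuous_at_sequentially comp_def
proof (intro allI impI)
  fix s :: "nat \<Rightarrow> real" assume s: "s \<longlonglongrightarrow> x"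
  have "(\<lambda>n. indicat_real {..s n} u) \<longlonglongrightarrow> indicat_real {..x} u" if "u \<noteq> x" for u
  proof (cases "u < x")
    case True
    then have "eventually (\<lambda>n. u < s n) sequentially" using order_tendstoD(1)[OF s] by simp
    then show ?thesis using True
      by (intro tendsto_eventually) (auto elim!: eventually_mono simp: indicator_def)
  next
    case False
    then have "x < u" using that by simp
    moreover from this have "eventually (\<lambda>n. s n < u) sequentially" using order_tendstoD(2)[OF s] by simp
    ultimately show ?thesis
      by (intro tendsto_eventually) (auto elim!: eventually_mono simp: indicator_def)
  qed
  then have "AE u in lborel. (\<lambda>n. indicat_real {..s n} u) \<longlonglongrightarrow> indicat_real {..x} u"
    using AE_lborel_singleton[of x] by (auto elim!: eventually_mono)
  from half_line_integral_tendsto[OF g _ this]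
  show "(\<lambda>n. LBINT u:{..s n}. g u) \<longlonglongrightarrow> (LBINT u:{..x}. g u)"
    by (simp add: set_lebesgue_integral_def)
qed

lemma kernel_cdf_at_infinity:
  assumes "is_kernel k" "filterlim s at_top sequentially"
  shows "(\<lambda>n. kernel_cdf k (s n)) \<longlonglongrightarrow> 1"
proof -
  have g: "integrable lborel k" "integral\<^sup>L lborel k = 1"
    using assms(1) by (auto simp: is_kernel_def has_bochner_integral_iff)
  have "(\<lambda>n. indicat_real {..s n} u) \<longlonglongrightarrow> 1" for u
    using assms(2)[unfolded filterlim_at_top, rule_format, of u]
    by (intro tendsto_eventually) (auto elim!: eventually_mono simp: indicator_def)
  then show ?thesis
    using half_line_integral_tendsto[OF g(1), of "\<lambda>_. 1" s] g(2)
    by (simp add: kernel_cdf_def)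
qed

lemma kernel_cdf_at_minus_infinity:
  assumes "is_kernel k" "filterlim s at_bot sequentially"
  shows "(\<lambda>n. kernel_cdf k (s n)) \<longlonglongrightarrow> 0"
proof -
  have g: "integrable lborel k"
    using assms(1) by (auto simp: is_kernel_def has_bochner_integral_iff)
  have "(\<lambda>n. indicat_real {..s n} u) \<longlonglongrightarrow> 0" for u
    using assms(2)[unfolded filterlim_at_bot_dense, rule_format, of u]
    by (intro tendsto_eventually) (auto elim!: eventually_mono simp: indicator_def)
  then show ?thesis
    using half_line_integral_tendsto[OF g, of "\<lambda>_. 0" s] by (simp add: kernel_cdf_def)
qed

lemma abs_kernel_cdf_le:
  assumes "is_kernel k"
  shows "\<bar>kernel_cdf k t\<bar> \<le> (LBINT u. \<bar>k u\<bar>)"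
proof -
  have k: "integrable lborel k"
    using assms by (auto simp: is_kernel_def has_bochner_integral_iff)
  have "\<bar>kernel_cdf k t\<bar> \<le> (LBINT u. \<bar>indicat_real {..t} u * k u\<bar>)"
    unfolding kernel_cdf_def set_lebesgue_integral_def real_scaleR_def by (rule integral_abs_bound)
  also have "\<dots> \<le> (LBINT u. \<bar>k u\<bar>)"
    using k by (intro integral_mono' ) (auto simp: indicator_def)
  finally show ?thesis .
qed

lemma borel_measurable_kernel_cdf:
  assumes "is_kernel k"
  shows "kernel_cdf k \<in> borel_measurable borel"
proof -
  have "continuous_on UNIV (kernel_cdf k)"
    using isCont_half_line_integral[of k] assms
    by (auto simp: is_kernel_def has_bochner_integral_iff continuous_on_eq_continuous_at
        kernel_cdf_def[abs_def])
  then show ?thesis by (rule borel_measurable_continuous_onI)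
qed

text \<open>
  Dividing by a bandwidth that shrinks to 0 sends \<open>- x / h n\<close> to minus infinity for positive
  \<open>x\<close> and to plus infinity for negative \<open>x\<close>. At \<open>x = 0\<close> the sequence has the
  constant value \<open>1 - K 0\<close>, which need not be \<open>psi 0 = 1\<close>.
\<close>

lemma smoothed_step_tendsto_psi:
  assumes k: "is_kernel k" and h: "h \<longlonglongrightarrow> 0" "eventually (\<lambda>n. 0 < h n) sequentially"
    and "x \<noteq> 0"
  shows "(\<lambda>n. 1 - kernel_cdf k (- x / h n)) \<longlonglongrightarrow> psi x"
proof -
  have inv: "filterlim (\<lambda>n. inverse (h n)) at_top sequentially"
    using h by (intro filterlim_inverse_at_top)
  show ?thesis
  proof (cases "x > 0")
    case True
    have "filterlim (\<lambda>n. - x * inverse (h n)) at_bot sequentially"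
      using True inv by (intro filterlim_tendsto_neg_mult_at_bot[OF tendsto_const]) auto
    from tendsto_diff[OF tendsto_const kernel_cdf_at_minus_infinity[OF k this], of 1]
    show ?thesis using True by (simp add: psi_def divide_inverse)
  next
    case False
    then have "filterlim (\<lambda>n. - x * inverse (h n)) at_top sequentially"
      using inv \<open>x \<noteq> 0\<close> by (intro filterlim_tendsto_pos_mult_at_top[OF tendsto_const]) auto
    from tendsto_diff[OF tendsto_const kernel_cdf_at_infinity[OF k this], of 1]
    show ?thesis using False \<open>x \<noteq> 0\<close> by (simp add: psi_def divide_inverse)
  qed
qed

section \<open>Standardizing bounded random variables\<close>

lemma (in prob_space) abs_standardized_le:
  fixes u :: "'a \<Rightarrow> real"
  assumes "u \<in> borel_measurable M" "\<And>x. \<bar>u x\<bar> \<le> C"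
  shows "\<bar>standardized M u x\<bar> \<le> 2 * C * (1 / sqrt (variance u))"
proof -
  have "\<bar>expectation u\<bar> \<le> expectation (\<lambda>x. \<bar>u x\<bar>)" by (rule integral_abs_bound)
  also have "\<dots> \<le> C"
    using assms by (intro integral_le_const integrable_const_bound[where B = C]) auto
  finally have "\<bar>u x - expectation u\<bar> \<le> 2 * C"
    using assms(2)[of x] by linarith
  then show ?thesis
    unfolding standardized_def abs_divide
    by (simp add: variance_positive divide_right_mono)
qed

lemma (in prob_space) bounded_convergence:
  fixes g :: "'a \<Rightarrow> real" and g' :: "nat \<Rightarrow> 'a \<Rightarrow> real"
  assumes "g \<in> borel_measurable M" "\<And>n. g' n \<in> borel_measurable M"
    and "\<And>n x. \<bar>g' n x\<bar> \<le> C" and "AE x in M. (\<lambda>n. g' n x) \<longlonglongrightarrow> g x"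
  shows "(\<lambda>n. expectation (g' n)) \<longlonglongrightarrow> expectation g"
  using assms by (intro integral_dominated_convergence[where w = "\<lambda>_. C"]) auto

lemma (in prob_space) variance_tendsto_bounded:
  fixes g :: "'a \<Rightarrow> real" and g' :: "nat \<Rightarrow> 'a \<Rightarrow> real"
  assumes meas [measurable]: "g \<in> borel_measurable M" "\<And>n. g' n \<in> borel_measurable M"
    and bnd: "\<And>n x. \<bar>g' n x\<bar> \<le> C" and lim: "AE x in M. (\<lambda>n. g' n x) \<longlonglongrightarrow> g x"
  shows "(\<lambda>n. variance (g' n)) \<longlonglongrightarrow> variance g"
proof -
  note E = bounded_convergence[OF meas bnd lim]
  obtain B where B: "\<And>n. \<bar>expectation (g' n)\<bar> \<le> B"
    using convergent_imp_Bseq[OF convergentI[OF E]] by (auto simp: Bseq_def)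
  show ?thesis
  proof (rule bounded_convergence[where C = "(C + B)\<^sup>2"])
    show "\<bar>(g' n x - expectation (g' n))\<^sup>2\<bar> \<le> (C + B)\<^sup>2" for n x
      using bnd[of n x] B[of n] by (simp add: abs_le_square_iff[symmetric])
    show "AE x in M. (\<lambda>n. (g' n x - expectation (g' n))\<^sup>2) \<longlonglongrightarrow> (g x - expectation g)\<^sup>2"
      using lim by eventually_elim (intro tendsto_intros E)
  qed auto
qed

text \<open>
  Positivity of the variance of the limit keeps the factors \<open>1 / sqrt (variance (g' n))\<close> convergent
  and hence bounded, so the standardized variables are again uniformly bounded and converge almost
  everywhere; bounded convergence then applies to their squared difference.
\<close>

lemma (in prob_space) standardized_tendsto_bounded:
  fixes g :: "'a \<Rightarrow> real" and g' :: "nat \<Rightarrow> 'a \<Rightarrow> real"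
  assumes meas [measurable]: "g \<in> borel_measurable M" "\<And>n. g' n \<in> borel_measurable M"
    and bnd: "\<And>x. \<bar>g x\<bar> \<le> C" "\<And>n x. \<bar>g' n x\<bar> \<le> C"
    and lim: "AE x in M. (\<lambda>n. g' n x) \<longlonglongrightarrow> g x" and pos: "variance g > 0"
  shows "(\<lambda>n. expectation (\<lambda>x. (standardized M g x - standardized M (g' n) x)\<^sup>2)) \<longlonglongrightarrow> 0"
proof -
  have E: "(\<lambda>n. expectation (g' n)) \<longlonglongrightarrow> expectation g"
    by (rule bounded_convergence[OF meas bnd(2) lim])
  have V: "(\<lambda>n. variance (g' n)) \<longlonglongrightarrow> variance g"
    by (rule variance_tendsto_bounded[OF meas bnd(2) lim])
  have std: "(\<lambda>n. standardized M (g' n) x) \<longlonglongrightarrow> standardized M g x"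
    if "(\<lambda>n. g' n x) \<longlonglongrightarrow> g x" for x
    unfolding standardized_def using that pos by (intro tendsto_intros E V) auto
  have "(\<lambda>n. 1 / sqrt (variance (g' n))) \<longlonglongrightarrow> 1 / sqrt (variance g)"
    using pos by (intro tendsto_intros V) auto
  \<comment> \<open>Terms with variance 0 are harmless: there \<open>1 / sqrt 0 = 0\<close>.\<close>
  then obtain S where S: "\<And>n. 1 / sqrt (variance (g' n)) \<le> S"
    using convergent_imp_Bseq[OF convergentI] by (fastforce simp: Bseq_def abs_le_iff)
  have "C \<ge> 0" using bnd(1)[of undefined] by linarith
  define T where "T = 2 * C * (1 / sqrt (variance g)) + 2 * C * S"
  have "(\<lambda>n. expectation (\<lambda>x. (standardized M g x - standardized M (g' n) x)\<^sup>2))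
      \<longlonglongrightarrow> expectation (\<lambda>x. 0)"
  proof (rule bounded_convergence[where C = "T\<^sup>2"])
    show "\<bar>(standardized M g x - standardized M (g' n) x)\<^sup>2\<bar> \<le> T\<^sup>2" for n x
    proof -
      have "2 * C * (1 / sqrt (variance (g' n))) \<le> 2 * C * S"
        using S[of n] \<open>C \<ge> 0\<close> by (intro mult_left_mono) auto
      then have "\<bar>standardized M g x - standardized M (g' n) x\<bar> \<le> T"
        using abs_standardized_le[OF meas(1) bnd(1), of x] abs_standardized_le[OF meas(2) bnd(2), of n x]
        unfolding T_def by linarith
      then show ?thesis by (simp add: abs_le_square_iff[symmetric])
    qed
    show "(\<lambda>x. (standardized M g x - standardized M (g' n) x)\<^sup>2) \<in> borel_measurable M" for n
      unfolding standardized_def by measurable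
    show "AE x in M. (\<lambda>n. (standardized M g x - standardized M (g' n) x)\<^sup>2) \<longlonglongrightarrow> 0"
      using lim
    proof eventually_elim
      case (elim x)
      have "(\<lambda>n. (standardized M g x - standardized M (g' n) x)\<^sup>2)
          \<longlonglongrightarrow> (standardized M g x - standardized M g x)\<^sup>2"
        by (intro tendsto_intros std elim)
      then show ?case by simp
    qed
  qed simp
  then show ?thesis by simp
qed


section \<open>Sums over an i.i.d. sample\<close>

text \<open>
  Pairwise independence makes every mixed product of centred variables have expectation 0, so only
  the diagonal of the expanded square survives.
\<close>

lemma (in prob_space) expectation_square_sum_indep_centred:
  fixes Y :: "nat \<Rightarrow> 'a \<Rightarrow> real"
  assumes "finite I" and ind: "indep_vars (\<lambda>_. borel) Y I"
    and int: "\<And>i. i \<in> I \<Longrightarrow> integrable M (Y i)"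
    and int2: "\<And>i. i \<in> I \<Longrightarrow> integrable M (\<lambda>\<omega>. (Y i \<omega>)\<^sup>2)"
    and mean: "\<And>i. i \<in> I \<Longrightarrow> expectation (Y i) = 0"
  shows "expectation (\<lambda>\<omega>. (\<Sum>i\<in>I. Y i \<omega>)\<^sup>2) = (\<Sum>i\<in>I. expectation (\<lambda>\<omega>. (Y i \<omega>)\<^sup>2))"
proof -
  have pair: "indep_var borel (Y i) borel (Y j)" if "i \<in> I" "j \<in> I" "i \<noteq> j" for i j
    using indep_vars_sum[of "{j}" i Y] indep_vars_subset[OF ind, of "{i, j}"] that by simp
  have prod: "integrable M (\<lambda>\<omega>. Y i \<omega> * Y j \<omega>)" if "i \<in> I" "j \<in> I" for i j
    using int2 indep_var_integrable[OF pair int int] that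
    by (cases "i = j") (auto simp: power2_eq_square)
  have cross: "expectation (\<lambda>\<omega>. Y i \<omega> * Y j \<omega>) = (if j = i then expectation (\<lambda>\<omega>. (Y i \<omega>)\<^sup>2) else 0)"
    if "i \<in> I" "j \<in> I" for i j
    using indep_var_lebesgue_integral[OF pair int int, of i j] mean that
    by (auto simp: power2_eq_square)
  have "expectation (\<lambda>\<omega>. (\<Sum>i\<in>I. Y i \<omega>)\<^sup>2) = (\<Sum>i\<in>I. \<Sum>j\<in>I. expectation (\<lambda>\<omega>. Y i \<omega> * Y j \<omega>))"
    using prod by (simp add: power2_eq_square sum_product Bochner_Integration.integral_sum)
  also have "\<dots> = (\<Sum>i\<in>I. expectation (\<lambda>\<omega>. (Y i \<omega>)\<^sup>2))"
    using \<open>finite I\<close> by (intro sum.cong) (simp_all add: cross sum.delta)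
  finally show ?thesis .
qed

locale iid_sample = prob_space M for M :: "'a measure" +
  fixes X :: "nat \<Rightarrow> 'a \<Rightarrow> real" and D :: "real measure"
  assumes indep: "indep_vars (\<lambda>_. borel) X {1..}"
    and distr: "\<And>j. j \<ge> 1 \<Longrightarrow> distr M borel (X j) = D"
begin

lemma X_measurable [measurable]: "j \<ge> 1 \<Longrightarrow> X j \<in> borel_measurable M"
  using indep by (auto simp: indep_vars_def)

sublocale D: real_distribution D
  using real_distribution_distr[OF X_measurable, of 1] unfolding distr[OF order_refl] by blast

lemma expectation_X:
  fixes g :: "real \<Rightarrow> real"
  assumes "j \<ge> 1" "g \<in> borel_measurable borel"
  shows "expectation (\<lambda>\<omega>. g (X j \<omega>)) = (LINT x|D. g x)"
  using assms integral_distr[of "X j" M borel g] by (simp add: distr)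

lemma expectation_square_sum:
  fixes q :: "real \<Rightarrow> real"
  assumes q: "q \<in> borel_measurable borel" "\<And>x. \<bar>q x\<bar> \<le> C" and mean: "(LINT x|D. q x) = 0"
  shows "expectation (\<lambda>\<omega>. (\<Sum>i=1..n. q (X i \<omega>))\<^sup>2) = real n * (LINT x|D. (q x)\<^sup>2)"
proof -
  have ind: "indep_vars (\<lambda>_. borel) (\<lambda>i \<omega>. q (X i \<omega>)) {1..n}"
    using indep_vars_compose2[OF indep_vars_subset[OF indep], of "{1..n}" "\<lambda>_. q"] q by auto
  have meas: "(\<lambda>\<omega>. q (X i \<omega>)) \<in> borel_measurable M" if "i \<in> {1..n}" for i
    using q(1) that by (auto intro: measurable_compose[OF X_measurable])
  have "integrable M (\<lambda>\<omega>. q (X i \<omega>))" if "i \<in> {1..n}" for i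
    using meas[OF that] q(2) by (intro integrable_const_bound[where B = C]) auto
  moreover have "integrable M (\<lambda>\<omega>. (q (X i \<omega>))\<^sup>2)" if "i \<in> {1..n}" for i
    using meas[OF that] power_mono[OF q(2) abs_ge_zero, of _ 2]
    by (intro integrable_const_bound[where B = "C\<^sup>2"]) auto
  ultimately have "expectation (\<lambda>\<omega>. (\<Sum>i=1..n. q (X i \<omega>))\<^sup>2)
      = (\<Sum>i=1..n. expectation (\<lambda>\<omega>. (q (X i \<omega>))\<^sup>2))"
    using expectation_X[OF _ q(1)] mean
    by (intro expectation_square_sum_indep_centred ind) auto
  also have "\<dots> = (\<Sum>i=1..n. (LINT x|D. (q x)\<^sup>2))"
    using q(1) by (intro sum.cong expectation_X[where g = "\<lambda>x. (q x)\<^sup>2"] refl) auto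
  finally show ?thesis by simp
qed

text \<open>
  The mean of the sum is \<open>n\<close> times, and its standard deviation \<open>\<surd>n\<close> times, that of
  one summand. A summand of variance 0 is covered: both sides are then 0, as division by 0 gives 0.
\<close>

lemma standardized_sum:
  fixes g :: "real \<Rightarrow> real"
  assumes g: "g \<in> borel_measurable borel" "\<And>x. \<bar>g x\<bar> \<le> C"
  shows "standardized M (\<lambda>\<omega>. \<Sum>i=1..n. g (X i \<omega>)) \<omega>
    = (\<Sum>i=1..n. standardized D g (X i \<omega>)) / sqrt n"
proof -
  let ?\<mu> = "LINT x|D. g x"
  have int: "integrable D g" using g by (intro D.integrable_const_bound[where B = C]) auto
  have intX: "integrable M (\<lambda>\<omega>. g (X i \<omega>))" if "i \<ge> 1" for i
    using g that by (intro integrable_const_bound[where B = C]) 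
      (auto intro: measurable_compose[OF X_measurable])
  have bound: "\<bar>g x - ?\<mu>\<bar> \<le> C + \<bar>?\<mu>\<bar>" for x
    using g(2)[of x] by linarith
  have E: "expectation (\<lambda>\<omega>. \<Sum>i=1..n. g (X i \<omega>)) = real n * ?\<mu>"
    using expectation_X[OF _ g(1)] intX by (simp add: Bochner_Integration.integral_sum)
  have dev: "(\<Sum>i=1..n. g (X i \<omega>)) - real n * ?\<mu> = (\<Sum>i=1..n. g (X i \<omega>) - ?\<mu>)" for \<omega>
    by (simp add: sum_subtractf)
  have mean: "(LINT x|D. (g x - ?\<mu>)) = 0"
    using int D.prob_space by simp
  have V: "expectation (\<lambda>\<omega>. ((\<Sum>i=1..n. g (X i \<omega>)) - real n * ?\<mu>)\<^sup>2) = real n * D.variance g"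
    unfolding dev
    using g(1) by (intro expectation_square_sum[OF _ bound mean]) auto
  show ?thesis
    unfolding standardized_def E V unfolding dev
    by (simp add: real_sqrt_mult sum_divide_distrib mult.commute)
qed

text \<open>
  The difference of the two standardized sums is \<open>1 / \<surd>n\<close> times the sum of the centred
  function \<open>?q\<close> over the sample, whose second moment is \<open>n\<close> times that of \<open>?q\<close>.
\<close>

lemma expectation_square_standardized_diff:
  fixes g g' :: "real \<Rightarrow> real"
  assumes g: "g \<in> borel_measurable borel" "\<And>x. \<bar>g x\<bar> \<le> C"
    and g': "g' \<in> borel_measurable borel" "\<And>x. \<bar>g' x\<bar> \<le> C"
    and "n \<ge> 1"
  shows "expectation (\<lambda>\<omega>. (standardized M (\<lambda>\<omega>. \<Sum>i=1..n. g (X i \<omega>)) \<omega>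
            - standardized M (\<lambda>\<omega>. \<Sum>i=1..n. g' (X i \<omega>)) \<omega>)\<^sup>2)
    = (LINT x|D. (standardized D g x - standardized D g' x)\<^sup>2)"
proof -
  have std: "standardized D u \<in> borel_measurable borel" "(LINT x|D. standardized D u x) = 0"
    "integrable D (standardized D u)"
    if u: "u \<in> borel_measurable borel" "\<And>x. \<bar>u x\<bar> \<le> C" for u
  proof -
    have int: "integrable D u" using u by (intro D.integrable_const_bound[where B = C]) auto
    show "standardized D u \<in> borel_measurable borel"
      using u(1) by (simp add: standardized_def[abs_def])
    show "integrable D (standardized D u)" "(LINT x|D. standardized D u x) = 0"
      using int D.prob_space by (simp_all add: standardized_def[abs_def])
  qed
  let ?q = "\<lambda>x. standardized D g x - standardized D g' x"
  have "expectation (\<lambda>\<omega>. (standardized M (\<lambda>\<omega>. \<Sum>i=1..n. g (X i \<omega>)) \<omega>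
            - standardized M (\<lambda>\<omega>. \<Sum>i=1..n. g' (X i \<omega>)) \<omega>)\<^sup>2)
      = expectation (\<lambda>\<omega>. (\<Sum>i=1..n. ?q (X i \<omega>))\<^sup>2) / real n"
    unfolding standardized_sum[OF g] standardized_sum[OF g']
    by (simp add: diff_divide_distrib[symmetric] sum_subtractf[symmetric] power_divide)
  also have "expectation (\<lambda>\<omega>. (\<Sum>i=1..n. ?q (X i \<omega>))\<^sup>2) = real n * (LINT x|D. (?q x)\<^sup>2)"
  proof (rule expectation_square_sum)
    show "?q \<in> borel_measurable borel" using std(1)[OF g] std(1)[OF g'] by simp
    show "(LINT x|D. ?q x) = 0" using std(2,3)[OF g] std(2,3)[OF g'] by simp
    show "\<bar>?q x\<bar> \<le> 2 * C * (1 / sqrt (D.variance g)) + 2 * C * (1 / sqrt (D.variance g'))" for x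
      using D.abs_standardized_le[OF _ g(2), where x = x] g(1)
        D.abs_standardized_le[OF _ g'(2), where x = x] g'(1)
      by (intro order_trans[OF abs_triangle_ineq4] add_mono) simp_all
  qed
  finally show ?thesis using \<open>n \<ge> 1\<close> by simp
qed

end

section \<open>Equivalence of the standardized sign statistics\<close>

theorem theorem2:
  fixes M :: "'a measure"
    and X :: "nat \<Rightarrow> 'a \<Rightarrow> real"
    and F f k :: "real \<Rightarrow> real"
    and h :: "nat \<Rightarrow> real"
    and \<theta> c d L :: real
    and U :: "real set"
    and i :: nat
  assumes "prob_space M"
    and "prob_space.indep_vars M (\<lambda>_. borel) X {1..}"
    and "\<And>j x. j \<ge> 1 \<Longrightarrow> cdf (distr M borel (X j)) x = F (x - \<theta>)"
    and "has_density F f"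
    and "\<And>x. f (- x) = f x"
    and "is_kernel k"
    and "open U" and "- \<theta> \<in> U"
    and "\<And>x. x \<in> U \<Longrightarrow> f differentiable (at x)"
    and "continuous_on U (deriv f)"
    and "c > 0" and "1 / 4 < d" and "d < 1 / 2"
    and "\<And>n. n \<ge> 1 \<Longrightarrow> h n = c * real n powr (- d)"
    and "\<And>u. k (- u) = k u"
    and "i \<ge> 1"
    and "(\<lambda>n. prob_space.variance M (\<lambda>\<omega>. 1 - kernel_cdf k (- (X i \<omega>) / h n)))
           \<longlonglongrightarrow> L"
    and "0 < L"
  shows "(\<lambda>n. prob_space.expectation M (\<lambda>\<omega>.
            (standardized M (sign_stat X n) \<omega>
             - standardized M (smoothed_sign_stat k h X n) \<omega>)\<^sup>2))
         \<longlonglongrightarrow> 0"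
proof -
  note indep = assms(2) and cdf = assms(3) and F = assms(4) and k = assms(6)
  note h = assms(14) and i = assms(16) and var_L = assms(17)
  interpret prob_space M by fact
  have X [measurable]: "X j \<in> borel_measurable M" if "j \<ge> 1" for j
    using indep that by (auto simp: indep_vars_def)
  define D where "D = distr M borel (X 1)"
  have D: "distr M borel (X j) = D" if "j \<ge> 1" for j
    unfolding D_def
    by (intro cdf_unique real_distribution_distr X that order_refl ext)
       (simp only: cdf[OF that] cdf[OF order_refl])
  interpret iid_sample M X D
    using indep D by unfold_locales auto

  have "isCont F (- \<theta>)"
  proof -
    have "F = (\<lambda>x. LBINT t:{..x}. f t)" "integrable lborel f"
      using F by (auto simp: has_density_def has_bochner_integral_iff)
    then show ?thesis using isCont_half_line_integral[of f] by simp
  qed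
  then have "isCont (\<lambda>x. F (x - \<theta>)) 0"
    by (intro isCont_o2[where f = "\<lambda>x. x - \<theta>" and g = F]) simp_all
  moreover have "cdf D = (\<lambda>x. F (x - \<theta>))"
    unfolding D_def by (intro ext cdf order_refl)
  ultimately have "measure D {0} = 0"
    by (simp add: D.isCont_cdf[symmetric])
  then have no_atom: "AE x in D. x \<noteq> 0"
    using D.prob_eq_0[of "{0}"] by simp

  \<comment> \<open>the summand of the smoothed sign statistic, which replaces the step \<open>psi\<close>\<close>
  define g' where "g' n x = 1 - kernel_cdf k (- x / h n)" for n x
  define C where "C = 1 + (LBINT u. \<bar>k u\<bar>)"
  have C: "\<bar>psi x\<bar> \<le> C" "\<bar>g' n x\<bar> \<le> C" for n x
  proof -
    have "0 \<le> (LBINT u. \<bar>k u\<bar>)" by simp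
    then show "\<bar>psi x\<bar> \<le> C" by (simp add: psi_def C_def)
    show "\<bar>g' n x\<bar> \<le> C"
      using abs_kernel_cdf_le[OF k, of "- x / h n"] unfolding g'_def C_def by linarith
  qed
  have meas: "psi \<in> borel_measurable borel" "g' n \<in> borel_measurable borel" for n
    using borel_measurable_kernel_cdf[OF k] unfolding psi_def[abs_def] g'_def[abs_def] by measurable
  have "h \<longlonglongrightarrow> 0"
  proof (rule Lim_transform_eventually)
    have "(\<lambda>n. real n powr (- d)) \<longlonglongrightarrow> 0"
      using assms(12) by (intro tendsto_neg_powr filterlim_real_sequentially) auto
    then show "(\<lambda>n. c * real n powr (- d)) \<longlonglongrightarrow> 0"
      by (rule tendsto_mult_right_zero)
    show "eventually (\<lambda>n. c * real n powr (- d) = h n) sequentially"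
      using eventually_ge_at_top[of 1] by eventually_elim (simp add: h)
  qed
  moreover have "eventually (\<lambda>n. 0 < h n) sequentially"
    using eventually_ge_at_top[of 1] by eventually_elim (use \<open>c > 0\<close> in \<open>simp add: h\<close>)
  ultimately have lim: "AE x in D. (\<lambda>n. g' n x) \<longlonglongrightarrow> psi x"
    using no_atom smoothed_step_tendsto_psi[OF k, of h] unfolding g'_def
    by (auto elim!: eventually_mono)

  \<comment> \<open>The assumed limit \<open>L\<close> of the variances is forced to be the variance of \<open>psi\<close>.\<close>
  have var_transfer: "variance (\<lambda>\<omega>. g' n (X i \<omega>)) = D.variance (g' n)" for n
    using expectation_X[OF i meas(2)[of n]]
      expectation_X[OF i, of "\<lambda>x. (g' n x - (LINT x|D. g' n x))\<^sup>2"] meas(2)[of n] by simp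
  have "(\<lambda>n. D.variance (g' n)) \<longlonglongrightarrow> D.variance psi"
    using meas C lim by (intro D.variance_tendsto_bounded) auto
  moreover have "(\<lambda>n. D.variance (g' n)) \<longlonglongrightarrow> L"
    using var_L unfolding var_transfer[symmetric] by (simp add: g'_def)
  ultimately have "D.variance psi > 0"
    using LIMSEQ_unique \<open>0 < L\<close> by blast
  then have limit: "(\<lambda>n. LINT x|D. (standardized D psi x - standardized D (g' n) x)\<^sup>2) \<longlonglongrightarrow> 0"
    using meas C lim by (intro D.standardized_tendsto_bounded) auto
  have moments: "expectation (\<lambda>\<omega>. (standardized M (sign_stat X n) \<omega>
        - standardized M (smoothed_sign_stat k h X n) \<omega>)\<^sup>2)
      = (LINT x|D. (standardized D psi x - standardized D (g' n) x)\<^sup>2)" if "n \<ge> 1" for n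
  proof -
    have "sign_stat X n = (\<lambda>\<omega>. \<Sum>i=1..n. psi (X i \<omega>))"
      by (simp add: sign_stat_def[abs_def])
    moreover have "smoothed_sign_stat k h X n = (\<lambda>\<omega>. \<Sum>i=1..n. g' n (X i \<omega>))"
      by (simp add: smoothed_sign_stat_def[abs_def] g'_def sum_subtractf)
    ultimately show ?thesis
      using expectation_square_standardized_diff[OF meas(1) C(1) meas(2) C(2) that] by simp
  qed
  have "eventually (\<lambda>n. (LINT x|D. (standardized D psi x - standardized D (g' n) x)\<^sup>2)
      = expectation (\<lambda>\<omega>. (standardized M (sign_stat X n) \<omega>
        - standardized M (smoothed_sign_stat k h X n) \<omega>)\<^sup>2)) sequentially"
    using eventually_ge_at_top[of 1] by eventually_elim (rule moments[symmetric])
  with limit show ?thesis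
    by (rule Lim_transform_eventually)
qed

end
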